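(* Let $\mathsf R$ be an ordered ring and $\mathsf C=\mathsf R(\mathrm i)$ with $\mathrm i^2=-1$. Let $\mathcal A$ be a $^*$-algebra over $\mathsf C$ and let $\boldsymbol{\mathcal A}=(\mathcal A[[\lambda]],\star)$ be a Hermitian deformation of $\mathcal A$. Let $\boldsymbol\omega:\boldsymbol{\mathcal A}\to\mathsf C[[\lambda]]$ be a deformation of a positive linear functional $\omega=\boldsymbol\omega_0:\mathcal A\to\mathsf C$ (that is, $\boldsymbol\omega=\sum_{r\ge 0}\lambda^r\boldsymbol\omega_r$ is a positive $\mathsf C[[\lambda]]$-linear functional on $\boldsymbol{\mathcal A}$ with $\boldsymbol\omega_0=\omega$). Let $(\boldsymbol{\mathcal H}_{\boldsymbol\omega},\boldsymbol\pi_{\boldsymbol\omega})$ be the GNS representation of $\boldsymbol{\mathcal A}$ corresponding to $\boldsymbol\omega$ and $(\mathcal H_\omega,\pi_\omega)$ the GNS representation of $\mathcal A$ corresponding to $\omega$. Then the classical limit $(\mathfrak C\boldsymbol{\mathcal H}_{\boldsymbol\omega},\mathfrak C\boldsymbol\pi_{\boldsymbol\omega})$ is canonically unitarily equivalent to $(\mathcal H_\omega,\pi_\omega)$ by means of the intertwiner $$U:\mathfrak C\boldsymbol{\mathcal H}_{\boldsymbol\omega}\ni\mathfrak C\psi_{\boldsymbol A}\mapsto\psi_{A}\in\mathcal H_\omega,$$ where $\boldsymbol A=\sum_{r=0}^\infty\lambda^r\boldsymbol A_r\in\boldsymbol{\mathcal A}$ and $A=\boldsymbol A_0$; that is, $U$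 is a well-defined unitary $\mathsf C$-linear map satisfying $U\,(\mathfrak C\boldsymbol\pi_{\boldsymbol\omega})(B)=\pi_\omega(B)\,U$ for all $B\in\mathcal A$.
   Context: Ordered rings: $\mathsf R$ is a commutative associative unital ordered ring; $\mathsf R[[\lambda]]$ is then also ordered, a nonzero formal series being positive iff its lowest-order nonzero coefficient is positive. $\mathsf C=\mathsf R(\mathrm i)$ carries complex conjugation $z\mapsto\overline z$, and $\mathsf C[[\lambda]]=\mathsf R[[\lambda]](\mathrm i)$ with $\overline\lambda=\lambda$. For $z\in\mathsf C$, writing $z>0$ or $z\ge0$ means $z\in\mathsf R$ and $z>0$ resp. $z\ge 0$. The following definitions are used over $\mathsf C$ and equally over $\mathsf C[[\lambda]]$ (with $\mathsf R[[\lambda]]$ as ordered ring). Pre-Hilbert space: a $\mathsf C$-module $\mathcal H$ with a map $\langle\cdot,\cdot\rangle:\mathcal H\times\mathcal H\to\mathsf C$, $\mathsf C$-linear in the second argument, with $\langle\phi,\psi\rangle=\overline{\langle\psi,\phi\rangle}$ and $\langle\chi,\chi\rangle>0$ for $\chi\neq0$. A map between pre-Hilbert spaces is unitary if it is a linear bijection preserving inner products. $\mathcal B(\mathcal H)$ denotes the $^*$-algebra of endomorphisms of $\mathcal H$ having an adjoint. $^*$-algebra over $\mathsf C$: an associative $\mathsf C$-algebra with an involutive antilinear anti-automorphism $A\mapsto A^*$. A $^*$-representation of $\mathcal A$ on $\mathcal H$ is a $^*$-homomorphism $\pi:\mathcal A\to\mathcal B(\mathcal H)$. Positive functional: a linear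 functional $\omega:\mathcal A\to\mathsf C$ with $\omega(A^*A)\ge0$ for all $A\in\mathcal A$. GNS representation: for positive $\omega$, the Gel'fand ideal $\mathcal J_\omega=\{A\in\mathcal A\mid\omega(A^*A)=0\}$ is a left ideal; $\mathcal H_\omega=\mathcal A/\mathcal J_\omega$, with $\psi_B\in\mathcal H_\omega$ the class of $B\in\mathcal A$, is a pre-Hilbert space via $\langle\psi_A,\psi_B\rangle=\omega(A^*B)$, and $\pi_\omega(A)\psi_B=\psi_{AB}$ is a $^*$-representation. For $\boldsymbol\omega$ the same construction is applied to the $^*$-algebra $\boldsymbol{\mathcal A}$ over $\mathsf C[[\lambda]]$, with product $\star$. Hermitian deformation: $\boldsymbol{\mathcal A}=(\mathcal A[[\lambda]],\star)$, where $\star$ is an associative $\mathsf C[[\lambda]]$-bilinear product on $\mathcal A[[\lambda]]$ of the form $A\star B=AB+\sum_{r\ge1}\lambda^rC_r(A,B)$ for $A,B\in\mathcal A$, with $\mathsf C$-bilinear maps $C_r:\mathcal A\times\mathcal A\to\mathcal A$ (formal deformation in the sense of Gerstenhaber), such that the $\mathsf C[[\lambda]]$-antilinear extension of the $^*$-involution of $\mathcal A$ is a $^*$-involution for $\star$. Classical limit: for a pre-Hilbert space $\boldsymbol{\mathcal H}$ over $\mathsf C[[\lambda]]$, put $\boldsymbol{\mathcal H}_0=\{\boldsymbol\phi\in\boldsymbol{\mathcal H}\mid\langle\boldsymbol\phi,\boldsymbol\phi\rangle|_{\lambda=0}=0\}$, a $\mathsf C[[\lambda]]$-submodule. Then $\mathfrak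 C\boldsymbol{\mathcal H}=\boldsymbol{\mathcal H}/\boldsymbol{\mathcal H}_0$, viewed as a $\mathsf C$-module, is a pre-Hilbert space over $\mathsf C$ with $\langle\mathfrak C\boldsymbol\phi,\mathfrak C\boldsymbol\psi\rangle=\langle\boldsymbol\phi,\boldsymbol\psi\rangle|_{\lambda=0}$, where $\mathfrak C:\boldsymbol{\mathcal H}\to\mathfrak C\boldsymbol{\mathcal H}$ also denotes the projection. For a $^*$-representation $\boldsymbol\pi$ of $\boldsymbol{\mathcal A}$ on $\boldsymbol{\mathcal H}$, its classical limit is the $^*$-representation $\mathfrak C\boldsymbol\pi$ of $\mathcal A$ on $\mathfrak C\boldsymbol{\mathcal H}$ given by $(\mathfrak C\boldsymbol\pi)(A)\,\mathfrak C\boldsymbol\psi=\mathfrak C(\boldsymbol\pi(A)\boldsymbol\psi)$ for $A\in\mathcal A$, $\boldsymbol\psi\in\boldsymbol{\mathcal H}$. *)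

theory Defs
  imports "HOL-Computational_Algebra.Formal_Power_Series"
    "HOL-Algebra.Module" "HOL-Algebra.AbelCoset"
begin

section \<open>Formal power series over an ordered ring form an ordered ring\<close>

definition fps_pos :: "'r::linordered_idom fps \<Rightarrow> bool"
  where "fps_pos f \<longleftrightarrow> 0 < fps_nth f (subdegree f)"

lemma not_fps_pos_0 [simp]: "\<not> fps_pos 0"
  by (simp add: fps_pos_def)

lemma fps_pos_total: "f = 0 \<or> fps_pos f \<or> fps_pos (- f)"
  using nth_subdegree_nonzero[of f] by (auto simp: fps_pos_def not_less_iff_gr_or_eq)

lemma fps_pos_add:
  assumes "fps_pos f" "fps_pos g"
  shows "fps_pos (f + g)"
proof -
  have nz: "f \<noteq> 0" "g \<noteq> 0"
    using assms by auto
  define n where "n = min (subdegree f) (subdegree g)"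
  have ge: "0 \<le> fps_nth h n" if "fps_pos h" "n \<le> subdegree h" for h
    using that by (cases "n = subdegree h") (simp_all add: fps_pos_def nth_less_subdegree_zero)
  have le: "n \<le> subdegree f" "n \<le> subdegree g"
    by (simp_all add: n_def)
  have "0 < fps_nth f n \<or> 0 < fps_nth g n"
    using assms by (auto simp: fps_pos_def n_def min_def)
  then have pos: "0 < fps_nth (f + g) n"
    using ge[OF assms(1) le(1)] ge[OF assms(2) le(2)] by (auto intro: add_pos_nonneg add_nonneg_pos)
  moreover have "fps_nth (f + g) i = 0" if "i < n" for i
    using that by (simp add: n_def nth_less_subdegree_zero)
  ultimately have "subdegree (f + g) = n"
    by (intro subdegreeI) auto
  with pos show ?thesis
    by (simp add: fps_pos_def)
qed

lemma fps_pos_mult: "fps_pos f \<Longrightarrow> fps_pos g \<Longrightarrow> fps_pos (f * g)"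
  by (cases "f = 0 \<or> g = 0") (auto simp: fps_pos_def)

instantiation fps :: (linordered_idom) linordered_idom
begin

definition "f < g \<longleftrightarrow> fps_pos (g - f)"

definition "f \<le> g \<longleftrightarrow> f = g \<or> fps_pos (g - f)"

definition "\<bar>f :: 'a fps\<bar> = (if f < 0 then - f else f)"

definition "sgn (f :: 'a fps) = (if f = 0 then 0 else if 0 < f then 1 else - 1)"

instance
proof
  fix f g h :: "'a fps"
  have asym: "\<not> (fps_pos (g - f) \<and> fps_pos (f - g))"
    using fps_pos_add[of "f - g" "g - f"] by force
  show "f < g \<longleftrightarrow> f \<le> g \<and> \<not> g \<le> f"
    using asym unfolding less_eq_fps_def less_fps_def by (metis diff_self not_fps_pos_0)
  show "f \<le> f"
    by (simp add: less_eq_fps_def)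
  show "f \<le> g \<Longrightarrow> g \<le> h \<Longrightarrow> f \<le> h"
    using fps_pos_add[of "g - f" "h - g"] by (force simp: less_eq_fps_def)
  show "f \<le> g \<Longrightarrow> g \<le> f \<Longrightarrow> f = g"
    using asym unfolding less_eq_fps_def by metis
  show "f \<le> g \<Longrightarrow> h + f \<le> h + g"
    by (simp add: less_eq_fps_def)
  show "f \<le> g \<or> g \<le> f"
    using fps_pos_total[of "f - g"] unfolding less_eq_fps_def by (metis eq_iff_diff_eq_0 minus_diff_eq)
  show "f < g \<Longrightarrow> 0 < h \<Longrightarrow> h * f < h * g"
    by (simp add: less_fps_def right_diff_distrib [symmetric] fps_pos_mult)
  show "\<bar>f\<bar> = (if f < 0 then - f else f)"
    by (rule abs_fps_def)
  show "sgn f = (if f = 0 then 0 else if 0 < f then 1 else - 1)"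
    by (rule sgn_fps_def)
qed

end

section \<open>The ring extension by a square root of minus one\<close>

text \<open>
  The type \<open>'r cx\<close> is \<open>R(i)\<close> for \<open>'r\<close> the ordered ring \<open>R\<close>.  The ring \<open>C[[\<lambda>]]\<close> is taken to be
  \<open>R[[\<lambda>]](i)\<close>, i.e. the type \<open>'r fps cx\<close>, so that every notion below that is defined over \<open>'r cx\<close>
  applies verbatim over \<open>C[[\<lambda>]]\<close>.
\<close>

datatype 'r cx = Cx (re: 'r) (im: 'r)

instantiation cx :: (comm_ring_1) comm_ring_1
begin

definition "0 = Cx 0 0"
definition "1 = Cx 1 0"
definition "z + w = Cx (re z + re w) (im z + im w)"
definition "z - w = Cx (re z - re w) (im z - im w)"
definition "- z = Cx (- re z) (- im z)"
definition "z * w = Cx (re z * re w - im z * im w) (re z * im w + im z * re w)"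

instance
  by standard
    (auto simp: zero_cx_def one_cx_def plus_cx_def minus_cx_def uminus_cx_def times_cx_def
      algebra_simps)

end

definition cx_cnj :: "'r::comm_ring_1 cx \<Rightarrow> 'r cx"
  where "cx_cnj z = Cx (re z) (- im z)"

definition cx_pos :: "'r::linordered_idom cx \<Rightarrow> bool"
  where "cx_pos z \<longleftrightarrow> im z = 0 \<and> 0 < re z"

definition cx_nonneg :: "'r::linordered_idom cx \<Rightarrow> bool"
  where "cx_nonneg z \<longleftrightarrow> im z = 0 \<and> 0 \<le> re z"

text \<open>The coefficient of \<open>\<lambda>\<^sup>n\<close>, and the embedding of \<open>C\<close> into \<open>C[[\<lambda>]]\<close>.\<close>

definition cx_nth :: "'r::comm_ring_1 fps cx \<Rightarrow> nat \<Rightarrow> 'r cx"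
  where "cx_nth z n = Cx (fps_nth (re z) n) (fps_nth (im z) n)"

definition cx_const :: "'r::comm_ring_1 cx \<Rightarrow> 'r fps cx"
  where "cx_const z = Cx (fps_const (re z)) (fps_const (im z))"

definition scalar_ring :: "'k::comm_ring_1 ring"
  where "scalar_ring = \<lparr>carrier = UNIV, mult = (*), one = 1, zero = 0, add = (+)\<rparr>"

section \<open>Pre-Hilbert spaces and star-algebras\<close>

definition linear_map :: "('k::comm_ring_1, 'a, 'm) module_scheme \<Rightarrow> ('k, 'b, 'n) module_scheme
    \<Rightarrow> ('a \<Rightarrow> 'b) \<Rightarrow> bool"
  where "linear_map M N f \<longleftrightarrow>
    f \<in> carrier M \<rightarrow> carrier N \<and>
    (\<forall>x\<in>carrier M. \<forall>y\<in>carrier M. f (x \<oplus>\<^bsub>M\<^esub> y) = f x \<oplus>\<^bsub>N\<^esub> f y) \<and>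
    (\<forall>z. \<forall>x\<in>carrier M. f (z \<odot>\<^bsub>M\<^esub> x) = z \<odot>\<^bsub>N\<^esub> f x)"

text \<open>
  The fields \<open>mult\<close> and \<open>one\<close> that module records inherit from ring records carry no meaning for
  pre-Hilbert spaces.
\<close>

record ('k, 'h) pre_hilbert = "('k, 'h) module" +
  ip :: "'h \<Rightarrow> 'h \<Rightarrow> 'k"

locale pre_hilbert = module scalar_ring H
  for H :: "('r::linordered_idom cx, 'h, 'm) pre_hilbert_scheme" (structure) +
  assumes ip_add: "\<lbrakk>\<phi> \<in> carrier H; \<psi> \<in> carrier H; \<chi> \<in> carrier H\<rbrakk>
      \<Longrightarrow> ip H \<phi> (\<psi> \<oplus>\<^bsub>H\<^esub> \<chi>) = ip H \<phi> \<psi> + ip H \<phi> \<chi>"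
    and ip_smult: "\<lbrakk>\<phi> \<in> carrier H; \<psi> \<in> carrier H\<rbrakk>
      \<Longrightarrow> ip H \<phi> (z \<odot>\<^bsub>H\<^esub> \<psi>) = z * ip H \<phi> \<psi>"
    and ip_cnj: "\<lbrakk>\<phi> \<in> carrier H; \<psi> \<in> carrier H\<rbrakk>
      \<Longrightarrow> ip H \<phi> \<psi> = cx_cnj (ip H \<psi> \<phi>)"
    and ip_pos: "\<lbrakk>\<chi> \<in> carrier H; \<chi> \<noteq> \<zero>\<^bsub>H\<^esub>\<rbrakk> \<Longrightarrow> cx_pos (ip H \<chi> \<chi>)"

definition unitary_map :: "('r::linordered_idom cx, 'h, 'm) pre_hilbert_scheme
    \<Rightarrow> ('r cx, 'k, 'n) pre_hilbert_scheme \<Rightarrow> ('h \<Rightarrow> 'k) \<Rightarrow> bool"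
  where "unitary_map H K U \<longleftrightarrow>
    pre_hilbert H \<and> pre_hilbert K \<and>
    linear_map H K U \<and> bij_betw U (carrier H) (carrier K) \<and>
    (\<forall>\<phi>\<in>carrier H. \<forall>\<psi>\<in>carrier H. ip K (U \<phi>) (U \<psi>) = ip H \<phi> \<psi>)"

text \<open>A star-algebra need not have a unit: the field \<open>one\<close> is not constrained.\<close>

record ('k, 'a) star_algebra = "('k, 'a) module" +
  star :: "'a \<Rightarrow> 'a"

locale star_algebra = module scalar_ring A
  for A :: "('r::linordered_idom cx, 'a, 'm) star_algebra_scheme" (structure) +
  assumes mult_closed: "\<lbrakk>a \<in> carrier A; b \<in> carrier A\<rbrakk> \<Longrightarrow> a \<otimes>\<^bsub>A\<^esub> b \<in> carrier A"
    and mult_assoc: "\<lbrakk>a \<in> carrier A; b \<in> carrier A; c \<in> carrier A\<rbrakk>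
      \<Longrightarrow> (a \<otimes>\<^bsub>A\<^esub> b) \<otimes>\<^bsub>A\<^esub> c = a \<otimes>\<^bsub>A\<^esub> (b \<otimes>\<^bsub>A\<^esub> c)"
    and mult_add_left: "\<lbrakk>a \<in> carrier A; b \<in> carrier A; c \<in> carrier A\<rbrakk>
      \<Longrightarrow> (a \<oplus>\<^bsub>A\<^esub> b) \<otimes>\<^bsub>A\<^esub> c = a \<otimes>\<^bsub>A\<^esub> c \<oplus>\<^bsub>A\<^esub> b \<otimes>\<^bsub>A\<^esub> c"
    and mult_add_right: "\<lbrakk>a \<in> carrier A; b \<in> carrier A; c \<in> carrier A\<rbrakk>
      \<Longrightarrow> a \<otimes>\<^bsub>A\<^esub> (b \<oplus>\<^bsub>A\<^esub> c) = a \<otimes>\<^bsub>A\<^esub> b \<oplus>\<^bsub>A\<^esub> a \<otimes>\<^bsub>A\<^esub> c"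
    and mult_smult_left: "\<lbrakk>a \<in> carrier A; b \<in> carrier A\<rbrakk>
      \<Longrightarrow> (z \<odot>\<^bsub>A\<^esub> a) \<otimes>\<^bsub>A\<^esub> b = z \<odot>\<^bsub>A\<^esub> (a \<otimes>\<^bsub>A\<^esub> b)"
    and mult_smult_right: "\<lbrakk>a \<in> carrier A; b \<in> carrier A\<rbrakk>
      \<Longrightarrow> a \<otimes>\<^bsub>A\<^esub> (z \<odot>\<^bsub>A\<^esub> b) = z \<odot>\<^bsub>A\<^esub> (a \<otimes>\<^bsub>A\<^esub> b)"
    and star_closed: "a \<in> carrier A \<Longrightarrow> star A a \<in> carrier A"
    and star_star: "a \<in> carrier A \<Longrightarrow> star A (star A a) = a"
    and star_add: "\<lbrakk>a \<in> carrier A; b \<in> carrier A\<rbrakk>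
      \<Longrightarrow> star A (a \<oplus>\<^bsub>A\<^esub> b) = star A a \<oplus>\<^bsub>A\<^esub> star A b"
    and star_smult: "a \<in> carrier A \<Longrightarrow> star A (z \<odot>\<^bsub>A\<^esub> a) = cx_cnj z \<odot>\<^bsub>A\<^esub> star A a"
    and star_mult: "\<lbrakk>a \<in> carrier A; b \<in> carrier A\<rbrakk>
      \<Longrightarrow> star A (a \<otimes>\<^bsub>A\<^esub> b) = star A b \<otimes>\<^bsub>A\<^esub> star A a"

definition star_hom :: "('k::comm_ring_1, 'a, 'm) star_algebra_scheme
    \<Rightarrow> ('k, 'b, 'n) star_algebra_scheme \<Rightarrow> ('a \<Rightarrow> 'b) \<Rightarrow> bool"
  where "star_hom A B f \<longleftrightarrow>
    linear_map A B f \<and>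
    (\<forall>a\<in>carrier A. \<forall>b\<in>carrier A. f (a \<otimes>\<^bsub>A\<^esub> b) = f a \<otimes>\<^bsub>B\<^esub> f b) \<and>
    (\<forall>a\<in>carrier A. f (star A a) = star B (f a))"

text \<open>
  Endomorphisms of a carrier-based module are represented by functions that are \<open>undefined\<close> outside
  the carrier, so that equality of endomorphisms is equality of functions.
\<close>

definition endomorphisms :: "('k::comm_ring_1, 'h, 'm) module_scheme \<Rightarrow> ('h \<Rightarrow> 'h) set"
  where "endomorphisms M = {T \<in> extensional (carrier M). linear_map M M T}"

definition is_adjoint :: "('k::comm_ring_1, 'h, 'm) pre_hilbert_scheme
    \<Rightarrow> ('h \<Rightarrow> 'h) \<Rightarrow> ('h \<Rightarrow> 'h) \<Rightarrow> bool"
  where "is_adjoint H T S \<longleftrightarrow>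
    S \<in> endomorphisms H \<and>
    (\<forall>\<phi>\<in>carrier H. \<forall>\<psi>\<in>carrier H. ip H (S \<phi>) \<psi> = ip H \<phi> (T \<psi>))"

definition adjointable_operators :: "('k::comm_ring_1, 'h, 'm) pre_hilbert_scheme
    \<Rightarrow> ('k, 'h \<Rightarrow> 'h) star_algebra"
  where "adjointable_operators H =
    \<lparr>carrier = {T \<in> endomorphisms H. \<exists>S. is_adjoint H T S},
     mult = compose (carrier H),
     one = (\<lambda>\<phi>\<in>carrier H. \<phi>),
     zero = (\<lambda>\<phi>\<in>carrier H. \<zero>\<^bsub>H\<^esub>),
     add = (\<lambda>S T. \<lambda>\<phi>\<in>carrier H. S \<phi> \<oplus>\<^bsub>H\<^esub> T \<phi>),
     smult = (\<lambda>z T. \<lambda>\<phi>\<in>carrier H. z \<odot>\<^bsub>H\<^esub> T \<phi>),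
     star = (\<lambda>T. THE S. is_adjoint H T S)\<rparr>"

definition star_representation :: "('r::linordered_idom cx, 'a, 'm) star_algebra_scheme
    \<Rightarrow> ('r cx, 'h, 'n) pre_hilbert_scheme \<Rightarrow> ('a \<Rightarrow> 'h \<Rightarrow> 'h) \<Rightarrow> bool"
  where "star_representation A H \<pi> \<longleftrightarrow>
    star_algebra A \<and> pre_hilbert H \<and> star_hom A (adjointable_operators H) \<pi>"

definition unitary_intertwiner :: "('r::linordered_idom cx, 'a, 'm) star_algebra_scheme
    \<Rightarrow> ('r cx, 'h, 'n) pre_hilbert_scheme \<Rightarrow> ('a \<Rightarrow> 'h \<Rightarrow> 'h)
    \<Rightarrow> ('r cx, 'k, 'p) pre_hilbert_scheme \<Rightarrow> ('a \<Rightarrow> 'k \<Rightarrow> 'k) \<Rightarrow> ('h \<Rightarrow> 'k) \<Rightarrow> bool"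
  where "unitary_intertwiner A H \<pi> K \<rho> U \<longleftrightarrow>
    star_representation A H \<pi> \<and> star_representation A K \<rho> \<and> unitary_map H K U \<and>
    (\<forall>a\<in>carrier A. \<forall>\<phi>\<in>carrier H. U (\<pi> a \<phi>) = \<rho> a (U \<phi>))"

section \<open>Positive functionals and the GNS representation\<close>

definition linear_functional :: "('k::comm_ring_1, 'a, 'm) module_scheme \<Rightarrow> ('a \<Rightarrow> 'k) \<Rightarrow> bool"
  where "linear_functional M \<omega> \<longleftrightarrow>
    (\<forall>x\<in>carrier M. \<forall>y\<in>carrier M. \<omega> (x \<oplus>\<^bsub>M\<^esub> y) = \<omega> x + \<omega> y) \<and>
    (\<forall>z. \<forall>x\<in>carrier M. \<omega> (z \<odot>\<^bsub>M\<^esub> x) = z * \<omega> x)"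

definition positive_functional :: "('r::linordered_idom cx, 'a, 'm) star_algebra_scheme
    \<Rightarrow> ('a \<Rightarrow> 'r cx) \<Rightarrow> bool"
  where "positive_functional A \<omega> \<longleftrightarrow>
    linear_functional A \<omega> \<and> (\<forall>a\<in>carrier A. cx_nonneg (\<omega> (star A a \<otimes>\<^bsub>A\<^esub> a)))"

text \<open>
  Operations on a quotient are given by their values on representatives.  Here \<open>the_elem\<close> returns
  the common value for all representatives; it is meaningful only if the operation is well defined.
  The scalar action and the inner product that descend to the quotient are explicit parameters,
  as they need not be those of \<open>M\<close>.
\<close>

definition quotient_space :: "('l, 'h, 'm) module_scheme \<Rightarrow> 'h set \<Rightarrow> ('k \<Rightarrow> 'h \<Rightarrow> 'h)
    \<Rightarrow> ('h \<Rightarrow> 'h \<Rightarrow> 'k) \<Rightarrow> ('k, 'h set) pre_hilbert"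
  where "quotient_space M N s p =
    \<lparr>carrier = a_rcosets\<^bsub>M\<^esub> N,
     mult = undefined,
     one = undefined,
     zero = N,
     add = set_add M,
     smult = (\<lambda>z X. the_elem ((\<lambda>x. N +>\<^bsub>M\<^esub> s z x) ` X)),
     ip = (\<lambda>X Y. the_elem ((\<lambda>(x, y). p x y) ` (X \<times> Y)))\<rparr>"

definition gelfand_ideal :: "('r::linordered_idom cx, 'a, 'm) star_algebra_scheme
    \<Rightarrow> ('a \<Rightarrow> 'r cx) \<Rightarrow> 'a set"
  where "gelfand_ideal A \<omega> = {a \<in> carrier A. \<omega> (star A a \<otimes>\<^bsub>A\<^esub> a) = 0}"

definition gns_vector :: "('r::linordered_idom cx, 'a, 'm) star_algebra_scheme
    \<Rightarrow> ('a \<Rightarrow> 'r cx) \<Rightarrow> 'a \<Rightarrow> 'a set"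
  where "gns_vector A \<omega> b = gelfand_ideal A \<omega> +>\<^bsub>A\<^esub> b"

definition gns_space :: "('r::linordered_idom cx, 'a, 'm) star_algebra_scheme
    \<Rightarrow> ('a \<Rightarrow> 'r cx) \<Rightarrow> ('r cx, 'a set) pre_hilbert"
  where "gns_space A \<omega> =
    quotient_space A (gelfand_ideal A \<omega>) (smult A) (\<lambda>a b. \<omega> (star A a \<otimes>\<^bsub>A\<^esub> b))"

definition gns_rep :: "('r::linordered_idom cx, 'a, 'm) star_algebra_scheme
    \<Rightarrow> ('a \<Rightarrow> 'r cx) \<Rightarrow> 'a \<Rightarrow> 'a set \<Rightarrow> 'a set"
  where "gns_rep A \<omega> a =
    (\<lambda>X\<in>carrier (gns_space A \<omega>). the_elem ((\<lambda>b. gns_vector A \<omega> (a \<otimes>\<^bsub>A\<^esub> b)) ` X))"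

section \<open>Hermitian deformations\<close>

definition bilinear_map :: "('k::comm_ring_1, 'a, 'm) module_scheme \<Rightarrow> ('a \<Rightarrow> 'a \<Rightarrow> 'a) \<Rightarrow> bool"
  where "bilinear_map M B \<longleftrightarrow>
    (\<forall>x\<in>carrier M. linear_map M M (B x)) \<and> (\<forall>y\<in>carrier M. linear_map M M (\<lambda>x. B x y))"

text \<open>
  Elements of \<open>A[[\<lambda>]]\<close> are sequences of coefficients.  Scalar multiplication by \<open>C[[\<lambda>]]\<close> is the Cauchy
  product, and the antilinear extension of the involution acts coefficientwise because \<open>\<lambda>\<close> is real.
\<close>

definition series_const :: "('k, 'a, 'm) star_algebra_scheme \<Rightarrow> 'a \<Rightarrow> nat \<Rightarrow> 'a"
  where "series_const A a = (\<lambda>n. if n = 0 then a else \<zero>\<^bsub>A\<^esub>)"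

definition series_algebra :: "('r::linordered_idom cx, 'a, 'm) star_algebra_scheme
    \<Rightarrow> ((nat \<Rightarrow> 'a) \<Rightarrow> (nat \<Rightarrow> 'a) \<Rightarrow> (nat \<Rightarrow> 'a)) \<Rightarrow> ('r fps cx, nat \<Rightarrow> 'a) star_algebra"
  where "series_algebra A m =
    \<lparr>carrier = {f. \<forall>n. f n \<in> carrier A},
     mult = m,
     one = undefined,
     zero = (\<lambda>n. \<zero>\<^bsub>A\<^esub>),
     add = (\<lambda>f g n. f n \<oplus>\<^bsub>A\<^esub> g n),
     smult = (\<lambda>z f n. \<Oplus>\<^bsub>A\<^esub>k\<in>{..n}. cx_nth z k \<odot>\<^bsub>A\<^esub> f (n - k)),
     star = (\<lambda>f n. star A (f n))\<rparr>"

definition hermitian_deformation :: "('r::linordered_idom cx, 'a, 'm) star_algebra_scheme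
    \<Rightarrow> ((nat \<Rightarrow> 'a) \<Rightarrow> (nat \<Rightarrow> 'a) \<Rightarrow> (nat \<Rightarrow> 'a)) \<Rightarrow> bool"
  where "hermitian_deformation A m \<longleftrightarrow>
    star_algebra (series_algebra A m) \<and>
    (\<exists>C. (\<forall>r\<ge>1. bilinear_map A (C r)) \<and>
      (\<forall>a\<in>carrier A. \<forall>b\<in>carrier A.
        m (series_const A a) (series_const A b) = (\<lambda>r. if r = 0 then a \<otimes>\<^bsub>A\<^esub> b else C r a b)))"

text \<open>
  \<open>\<Omega> = \<Sum>\<^sub>r \<lambda>\<^sup>r \<Omega>\<^sub>r\<close> with linear functionals \<open>\<Omega>\<^sub>r\<close> on \<open>A\<close> and \<open>\<Omega>\<^sub>0 = \<omega>\<close>.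
\<close>

definition functional_deformation :: "('r::linordered_idom cx, 'a, 'm) star_algebra_scheme
    \<Rightarrow> ('a \<Rightarrow> 'r cx) \<Rightarrow> ((nat \<Rightarrow> 'a) \<Rightarrow> 'r fps cx) \<Rightarrow> bool"
  where "functional_deformation A \<omega> \<Omega> \<longleftrightarrow>
    (\<exists>w. w 0 = \<omega> \<and> (\<forall>r. linear_functional A (w r)) \<and>
      (\<forall>a\<in>carrier A. \<forall>r. cx_nth (\<Omega> (series_const A a)) r = w r a))"

section \<open>The classical limit\<close>

definition null_space :: "('r::linordered_idom fps cx, 'h, 'm) pre_hilbert_scheme \<Rightarrow> 'h set"
  where "null_space H = {\<phi> \<in> carrier H. cx_nth (ip H \<phi> \<phi>) 0 = 0}"

definition cl_vector :: "('r::linordered_idom fps cx, 'h, 'm) pre_hilbert_scheme \<Rightarrow> 'h \<Rightarrow> 'h set"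
  where "cl_vector H \<phi> = null_space H +>\<^bsub>H\<^esub> \<phi>"

definition cl_space :: "('r::linordered_idom fps cx, 'h, 'm) pre_hilbert_scheme
    \<Rightarrow> ('r cx, 'h set) pre_hilbert"
  where "cl_space H =
    quotient_space H (null_space H) (\<lambda>z \<phi>. cx_const z \<odot>\<^bsub>H\<^esub> \<phi>) (\<lambda>\<phi> \<psi>. cx_nth (ip H \<phi> \<psi>) 0)"

definition cl_rep :: "('r::linordered_idom cx, 'a, 'm) star_algebra_scheme
    \<Rightarrow> ('r fps cx, 'h, 'n) pre_hilbert_scheme \<Rightarrow> ((nat \<Rightarrow> 'a) \<Rightarrow> 'h \<Rightarrow> 'h)
    \<Rightarrow> 'a \<Rightarrow> 'h set \<Rightarrow> 'h set"
  where "cl_rep A H \<pi> a =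
    (\<lambda>X\<in>carrier (cl_space H). the_elem ((\<lambda>\<psi>. cl_vector H (\<pi> (series_const A a) \<psi>)) ` X))"

end

theory Submission
  imports Defs
begin

text \<open>
  The GNS construction is characterised by its inner products: a pre-Hilbert space whose vectors
  are all of the form \<open>v a\<close> with \<open>\<langle>v a, v b\<rangle> = \<omega>(a\<^sup>* b)\<close>, acted upon by \<open>a \<cdot> v b = v (a b)\<close>, is determined
  up to a unique unitary map \<open>v a \<mapsto> w a\<close> respecting the vectors.  Because inner products are
  nondegenerate, every identity needed for this (linearity of \<open>v\<close>, independence of representatives,
  the laws of a star-representation) can be tested on inner products, where it becomes an identity in
  the algebra.  Such data are called a GNS model of \<open>\<omega>\<close> here; \<open>gns_model_unique\<close> is the uniqueness
  statement.  The algebra may lack a unit, so a model records the whole map \<open>v\<close> instead of a cyclic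
  vector.

  The theorem therefore reduces to the claim that the classical limit of the GNS representation of
  the deformed functional \<open>\<Omega>\<close> is a GNS model of \<open>\<omega>\<close>.  Write \<open>V f\<close> for the class in the classical
  limit of the GNS vector of a series \<open>f\<close>.  Then \<open>\<langle>V f, V g\<rangle>\<close> is the coefficient of order zero of
  \<open>\<Omega>(f\<^sup>* \<star> g)\<close>.  A \<open>C[[\<lambda>]]\<close>-linear map is determined modulo \<open>\<lambda>\<close> by its values on constant
  series, so modulo \<open>\<lambda>\<close> the deformed product is the undeformed one and \<open>\<Omega>\<close> is \<open>\<omega>\<close>; hence this
  coefficient is \<open>\<omega>(f\<^sub>0\<^sup>* g\<^sub>0)\<close>.  Two consequences follow: \<open>V f\<close> depends on \<open>f\<^sub>0\<close> only, so that the constant series already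
  exhaust the limit space; and restricted to constant series, \<open>V\<close> has the inner products that
  characterise the GNS vectors of \<open>\<omega>\<close>.

  Both quotients that occur, by the Gelfand ideal and by the vectors that are null at \<open>\<lambda> = 0\<close>, are the
  quotient of a module by the isotropic vectors of a positive semidefinite form, so they are treated
  together in the locale \<open>semi_hilbert\<close>.
\<close>

section \<open>Scalars\<close>

lemma cx_eq_iff: "z = w \<longleftrightarrow> re z = re w \<and> im z = im w"
  by (cases z; cases w) auto

lemma cx_sel [simp]:
  "re (0 :: 'r::comm_ring_1 cx) = 0" "im (0 :: 'r cx) = 0"
  "re (1 :: 'r cx) = 1" "im (1 :: 'r cx) = 0"
  "re (z + w :: 'r cx) = re z + re w" "im (z + w) = im z + im w"
  "re (z - w :: 'r cx) = re z - re w" "im (z - w) = im z - im w"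
  "re (- z :: 'r cx) = - re z" "im (- z) = - im z"
  "re (z * w :: 'r cx) = re z * re w - im z * im w" "im (z * w) = re z * im w + im z * re w"
  "re (cx_cnj z) = re z" "im (cx_cnj z) = - im z"
  by (simp_all add: zero_cx_def one_cx_def plus_cx_def minus_cx_def uminus_cx_def times_cx_def
      cx_cnj_def)

lemma cx_cnj_cnj [simp]: "cx_cnj (cx_cnj z) = z"
  and cx_cnj_add: "cx_cnj (z + w) = cx_cnj z + cx_cnj w"
  and cx_cnj_mult: "cx_cnj (z * w) = cx_cnj z * cx_cnj w"
  by (simp_all add: cx_eq_iff algebra_simps)

lemma scalar_ring_simps [simp]:
  "carrier scalar_ring = UNIV" "mult scalar_ring = (*)" "one scalar_ring = 1"
  "zero scalar_ring = 0" "add scalar_ring = (+)"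
  by (simp_all add: scalar_ring_def)

lemma cring_scalar_ring: "cring (scalar_ring :: 'k::comm_ring_1 ring)"
proof (rule cringI)
  show "abelian_group (scalar_ring :: 'k ring)"
    by (rule abelian_groupI) (auto simp: algebra_simps intro: exI[of _ "- _"])
  show "comm_monoid (scalar_ring :: 'k ring)"
    by (rule comm_monoidI) (simp_all add: algebra_simps)
qed (simp add: algebra_simps)

section \<open>Quotients by the isotropic vectors of a semidefinite form\<close>

text \<open>
  The scalar action \<open>s\<close> is a parameter because in the classical limit \<open>M\<close> is a module over \<open>C[[\<lambda>]]\<close>, while
  its quotient is formed over \<open>C\<close>.
\<close>

locale semi_hilbert = abelian_group M
  for M :: "('l, 'h, 'm) module_scheme" (structure) +
  fixes s :: "'r::linordered_idom cx \<Rightarrow> 'h \<Rightarrow> 'h"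
    and p :: "'h \<Rightarrow> 'h \<Rightarrow> 'r cx"
  assumes s_closed: "x \<in> carrier M \<Longrightarrow> s c x \<in> carrier M"
    and s_add_left: "x \<in> carrier M \<Longrightarrow> s (c + d) x = s c x \<oplus> s d x"
    and s_add_right: "\<lbrakk>x \<in> carrier M; y \<in> carrier M\<rbrakk> \<Longrightarrow> s c (x \<oplus> y) = s c x \<oplus> s c y"
    and s_mult: "x \<in> carrier M \<Longrightarrow> s (c * d) x = s c (s d x)"
    and s_one: "x \<in> carrier M \<Longrightarrow> s 1 x = x"
    and p_add_left: "\<lbrakk>x \<in> carrier M; y \<in> carrier M; z \<in> carrier M\<rbrakk>
      \<Longrightarrow> p (x \<oplus> y) z = p x z + p y z"
    and p_add_right: "\<lbrakk>x \<in> carrier M; y \<in> carrier M; z \<in> carrier M\<rbrakk>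
      \<Longrightarrow> p z (x \<oplus> y) = p z x + p z y"
    and p_s_left: "\<lbrakk>x \<in> carrier M; y \<in> carrier M\<rbrakk> \<Longrightarrow> p (s c x) y = cx_cnj c * p x y"
    and p_s_right: "\<lbrakk>x \<in> carrier M; y \<in> carrier M\<rbrakk> \<Longrightarrow> p x (s c y) = c * p x y"
    and p_nonneg: "x \<in> carrier M \<Longrightarrow> cx_nonneg (p x x)"
begin

text \<open>
  Polarization: the form is real on the diagonal, in particular at \<open>x + y\<close> and at \<open>x + i y\<close>.
\<close>

lemma p_hermitian:
  assumes "x \<in> carrier M" "y \<in> carrier M"
  shows "p y x = cx_cnj (p x y)"
proof -
  have "im (p (x \<oplus> y) (x \<oplus> y)) = 0"
    "im (p (x \<oplus> s (Cx 0 1) y) (x \<oplus> s (Cx 0 1) y)) = 0"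
    "im (p x x) = 0" "im (p y y) = 0"
    using assms p_nonneg by (simp_all add: cx_nonneg_def s_closed)
  then show ?thesis
    using assms
    by (simp add: p_add_left p_add_right p_s_left p_s_right s_closed cx_eq_iff algebra_simps
        eq_neg_iff_add_eq_0)
qed

text \<open>
  This is the part of the Cauchy-Schwarz inequality that makes the isotropic vectors a submodule.
  Over an ordered ring one can neither divide by the square of the modulus of \<open>b = p x y\<close> nor let a
  parameter grow past every bound, since that square may be infinitesimal.  Scaling both vectors
  avoids this: \<open>u = - (c + 1) b x + \<bar>b\<bar>\<^sup>2 y\<close> with \<open>c = p y y\<close> satisfies
  \<open>p u u = - \<bar>b\<bar>\<^sup>4 (c + 2)\<close>, which is nonnegative only for \<open>b = 0\<close>.
\<close>

lemma isotropic_orthogonal: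
  assumes x: "x \<in> carrier M" and y: "y \<in> carrier M" and "p x x = 0"
  shows "p x y = 0"
proof -
  define b c n where "b = p x y" and "c = re (p y y)" and "n = re b * re b + im b * im b"
  have c: "0 \<le> c" "im (p y y) = 0"
    using p_nonneg[OF y] by (simp_all add: cx_nonneg_def c_def)
  define u where "u = s (Cx (- (c + 1)) 0 * b) x \<oplus> s (Cx n 0) y"
  have "re (p u u) = - (n * n * (c + 2))"
    using assms p_hermitian[OF x y] c(2)
    by (simp add: u_def p_add_left p_add_right p_s_left p_s_right s_closed cx_cnj_mult
        flip: b_def c_def) (simp add: n_def algebra_simps)
  moreover have "0 \<le> re (p u u)"
    using p_nonneg[of u] x y by (simp add: u_def s_closed cx_nonneg_def)
  ultimately have "n * n * (c + 2) \<le> 0"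
    by simp
  moreover have "0 \<le> n"
    by (simp add: n_def sum_squares_ge_zero)
  ultimately have "n = 0"
    using c(1) mult_pos_pos[of "n * n" "c + 2"] mult_pos_pos[of n n]
    by (cases "n = 0") (auto simp: not_le[symmetric] add_nonneg_pos)
  then show ?thesis
    by (simp add: n_def b_def cx_eq_iff sum_squares_eq_zero_iff)
qed

definition isotropic :: "'h set"
  where "isotropic = {x \<in> carrier M. p x x = 0}"

abbreviation "cls x \<equiv> isotropic +> x"
abbreviation "quot \<equiv> quotient_space M isotropic s p"

lemma p_zero: "x \<in> carrier M \<Longrightarrow> p x \<zero> = 0"
  using p_add_right[of \<zero> \<zero> x] by simp

lemma p_minus:
  assumes "x \<in> carrier M" "y \<in> carrier M"
  shows "p x (\<ominus> y) = - p x y"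
proof -
  have "p x y + p x (\<ominus> y) = p x (y \<oplus> \<ominus> y)"
    using assms by (simp only: p_add_right a_inv_closed)
  also have "\<dots> = 0"
    using assms by (simp only: r_neg p_zero)
  finally show ?thesis
    by (simp only: add_eq_0_iff)
qed

lemma isotropic_iff:
  assumes "x \<in> carrier M"
  shows "x \<in> isotropic \<longleftrightarrow> (\<forall>z\<in>carrier M. p z x = 0)"
proof -
  have "p z x = 0" if "p x x = 0" "z \<in> carrier M" for z
    using isotropic_orthogonal[OF assms that(2,1)] p_hermitian[OF assms that(2)]
    by (simp add: cx_eq_iff)
  then show ?thesis
    using assms by (auto simp: isotropic_def)
qed

lemma abelian_subgroup_isotropic: "abelian_subgroup isotropic M"
proof (rule abelian_subgroupI3)
  have "\<ominus> x \<in> isotropic" "x \<oplus> y \<in> isotropic" if "x \<in> isotropic" "y \<in> isotropic" for x y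
  proof -
    have xy: "x \<in> carrier M" "y \<in> carrier M"
      using that by (auto simp: isotropic_def)
    with that have "p z x = 0" "p z y = 0" if "z \<in> carrier M" for z
      using that by (simp_all add: isotropic_iff)
    with xy show "\<ominus> x \<in> isotropic" "x \<oplus> y \<in> isotropic"
      by (simp_all add: isotropic_iff p_add_right p_minus)
  qed
  moreover have "\<zero> \<in> isotropic"
    by (simp add: isotropic_iff p_zero)
  ultimately show "additive_subgroup isotropic M"
    by (intro additive_subgroup.intro add.subgroupI) (auto simp: isotropic_def)
  show "abelian_group M"
    by (rule abelian_group_axioms)
qed

interpretation isotropic: abelian_subgroup isotropic M
  by (rule abelian_subgroup_isotropic)

lemma cls_eq_iff:
  assumes "x \<in> carrier M" "y \<in> carrier M"
  shows "cls x = cls y \<longleftrightarrow> (\<forall>z\<in>carrier M. p z x = p z y)"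
proof -
  have "cls x = cls y \<longleftrightarrow> x \<in> cls y"
    using isotropic.a_rcos_self[OF assms(1)] isotropic.a_repr_independence'[OF _ assms(2), of x]
    by (metis (no_types))
  also have "\<dots> \<longleftrightarrow> x \<ominus> y \<in> isotropic"
    using isotropic.a_rcos_module[OF assms(2,1)] by (simp only: minus_eq)
  also have "\<dots> \<longleftrightarrow> (\<forall>z\<in>carrier M. p z x = p z y)"
  proof -
    have "p z (x \<ominus> y) = p z x - p z y" if "z \<in> carrier M" for z
      using assms that by (simp only: minus_eq p_add_right p_minus a_inv_closed) simp
    then show ?thesis
      using isotropic_iff[of "x \<ominus> y"] assms by (simp only: minus_closed) simp
  qed
  finally show ?thesis .
qed

lemma mem_clsD:
  assumes "x \<in> carrier M" "y \<in> cls x"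
  shows "y \<in> carrier M" "cls y = cls x"
  using assms isotropic.a_elemrcos_carrier isotropic.a_repr_independence' by auto

lemma cls_nonempty: "x \<in> carrier M \<Longrightarrow> cls x \<noteq> {}"
  using isotropic.a_rcos_self by blast

lemma quot_carrier: "carrier quot = cls ` carrier M"
  by (auto simp: quotient_space_def A_RCOSETS_def')

lemma quot_zero: "\<zero>\<^bsub>quot\<^esub> = cls \<zero>"
  using isotropic.a_subset by (simp add: quotient_space_def)

lemma quot_add: "\<lbrakk>x \<in> carrier M; y \<in> carrier M\<rbrakk> \<Longrightarrow> cls x \<oplus>\<^bsub>quot\<^esub> cls y = cls (x \<oplus> y)"
  by (simp add: quotient_space_def isotropic.a_rcos_sum)

text \<open>
  An operator with a formal adjoint descends to the quotient: equality of classes is equality of inner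
  products with all vectors, and the adjoint moves the operator to the other side.  Scalar multiplication
  and the operators of both representations descend in this way.
\<close>

lemma operator_on_cls:
  assumes x: "x \<in> carrier M"
    and T: "\<And>y. y \<in> carrier M \<Longrightarrow> T y \<in> carrier M"
    and S: "\<And>y. y \<in> carrier M \<Longrightarrow> S y \<in> carrier M"
    and adj: "\<And>y z. \<lbrakk>y \<in> carrier M; z \<in> carrier M\<rbrakk> \<Longrightarrow> p z (T y) = p (S z) y"
  shows "the_elem ((\<lambda>y. cls (T y)) ` cls x) = cls (T x)"
proof (rule the_elem_image_unique)
  fix y assume "y \<in> cls x"
  then have y: "y \<in> carrier M" and "cls y = cls x"
    using mem_clsD[OF x] by auto
  then have "p z y = p z x" if "z \<in> carrier M" for z
    using cls_eq_iff x that by blast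
  then show "cls (T y) = cls (T x)"
    using x y T S by (simp add: cls_eq_iff adj)
qed (rule cls_nonempty[OF x])

lemma quot_smult:
  assumes "x \<in> carrier M"
  shows "c \<odot>\<^bsub>quot\<^esub> cls x = cls (s c x)"
  using operator_on_cls[of x "s c" "s (cx_cnj c)"] assms
  by (simp add: quotient_space_def s_closed p_s_left p_s_right)

lemma quot_ip:
  assumes x: "x \<in> carrier M" and y: "y \<in> carrier M"
  shows "ip quot (cls x) (cls y) = p x y"
proof -
  have "p x' y' = p x y" if "x' \<in> cls x" "y' \<in> cls y" for x' y'
  proof -
    note x' = mem_clsD[OF x that(1)] and y' = mem_clsD[OF y that(2)]
    have "p x' y' = p x' y"
      using cls_eq_iff[OF y'(1) y] y'(2) x'(1) by blast
    also have "\<dots> = cx_cnj (p y x')"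
      using y x'(1) by (rule p_hermitian)
    also have "p y x' = p y x"
      using cls_eq_iff[OF x'(1) x] x'(2) y by blast
    finally show ?thesis
      using p_hermitian[OF y x] by simp
  qed
  then have "the_elem ((\<lambda>(x, y). p x y) ` (cls x \<times> cls y)) = p x y"
    using cls_nonempty x y by (intro the_elem_image_unique) auto
  then show ?thesis
    by (simp add: quotient_space_def)
qed

theorem pre_hilbert_quot: "pre_hilbert quot"
proof -
  have "abelian_group quot"
  proof (rule abelian_groupI)
    fix X assume "X \<in> carrier quot"
    then obtain x where "x \<in> carrier M" "X = cls x"
      by (auto simp: quot_carrier)
    then show "\<exists>Y\<in>carrier quot. Y \<oplus>\<^bsub>quot\<^esub> X = \<zero>\<^bsub>quot\<^esub>"
      by (intro bexI[of _ "cls (\<ominus> x)"]) (simp_all add: quot_carrier quot_zero quot_add l_neg)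
  qed (auto simp: quot_carrier quot_zero quot_add a_ac)
  then have "module scalar_ring quot"
    by (intro moduleI cring_scalar_ring)
      (auto simp: quot_carrier quot_add quot_smult s_closed s_add_left s_add_right s_mult
        s_one)
  moreover have "pre_hilbert_axioms quot"
  proof
    fix \<chi> assume "\<chi> \<in> carrier quot" "\<chi> \<noteq> \<zero>\<^bsub>quot\<^esub>"
    then obtain x where x: "x \<in> carrier M" "\<chi> = cls x" and "cls x \<noteq> cls \<zero>"
      by (auto simp: quot_carrier quot_zero)
    then have "x \<notin> isotropic"
      using x by (auto simp: cls_eq_iff isotropic_iff p_zero)
    then have "p x x \<noteq> 0"
      using x(1) unfolding isotropic_def by blast
    moreover have "ip quot \<chi> \<chi> = p x x"
      using x by (simp only: quot_ip)
    ultimately show "cx_pos (ip quot \<chi> \<chi>)"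
      using p_nonneg[OF x(1)] by (auto simp: cx_pos_def cx_nonneg_def cx_eq_iff)
  next
    fix \<phi> \<psi> assume "\<phi> \<in> carrier quot" "\<psi> \<in> carrier quot"
    then obtain x y where "x \<in> carrier M" "y \<in> carrier M" "\<phi> = cls x" "\<psi> = cls y"
      by (auto simp: quot_carrier)
    then show "ip quot \<phi> \<psi> = cx_cnj (ip quot \<psi> \<phi>)"
      using p_hermitian[of y x] by (simp only: quot_ip)
  qed (auto simp: quot_carrier quot_add quot_smult quot_ip s_closed p_add_right p_s_right)
  ultimately show ?thesis
    by (rule pre_hilbert.intro)
qed

end

section \<open>Nondegeneracy of the inner product\<close>

context pre_hilbert
begin

lemma ip_add_left:
  assumes "\<phi> \<in> carrier H" "\<psi> \<in> carrier H" "\<chi> \<in> carrier H"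
  shows "ip H (\<phi> \<oplus> \<psi>) \<chi> = ip H \<phi> \<chi> + ip H \<psi> \<chi>"
  using assms ip_cnj[of "\<phi> \<oplus> \<psi>" \<chi>] ip_cnj[of \<phi> \<chi>] ip_cnj[of \<psi> \<chi>]
  by (simp add: ip_add cx_cnj_add)

lemma smult_carrier: "\<phi> \<in> carrier H \<Longrightarrow> z \<odot> \<phi> \<in> carrier H"
  by simp

lemma ip_smult_left:
  assumes "\<phi> \<in> carrier H" "\<psi> \<in> carrier H"
  shows "ip H (z \<odot> \<phi>) \<psi> = cx_cnj z * ip H \<phi> \<psi>"
  using assms ip_cnj[of "z \<odot> \<phi>" \<psi>] ip_cnj[of \<phi> \<psi>]
  by (simp add: ip_smult cx_cnj_mult smult_carrier)

lemma ip_zero: "\<phi> \<in> carrier H \<Longrightarrow> ip H \<phi> \<zero>\<^bsub>H\<^esub> = 0"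
  using ip_add[of \<phi> "\<zero>\<^bsub>H\<^esub>" "\<zero>\<^bsub>H\<^esub>"] by simp

lemma eq_by_ip:
  assumes "\<phi> \<in> carrier H" "\<psi> \<in> carrier H"
    and "\<And>\<chi>. \<chi> \<in> carrier H \<Longrightarrow> ip H \<chi> \<phi> = ip H \<chi> \<psi>"
  shows "\<phi> = \<psi>"
proof -
  define \<delta> where "\<delta> = \<phi> \<ominus>\<^bsub>H\<^esub> \<psi>"
  have \<delta>: "\<delta> \<in> carrier H"
    using assms by (simp add: \<delta>_def)
  have sum: "\<delta> \<oplus> \<psi> = \<phi>"
    using assms by (simp add: \<delta>_def M.minus_eq M.a_assoc M.l_neg)
  have "ip H \<delta> \<delta> + ip H \<delta> \<psi> = ip H \<delta> \<psi>"
    using ip_add[OF \<delta> \<delta> assms(2)] assms(3)[OF \<delta>] by (simp only: sum)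
  then have "ip H \<delta> \<delta> = 0"
    by simp
  then have "\<delta> = \<zero>\<^bsub>H\<^esub>"
    using ip_pos[OF \<delta>] by (auto simp: cx_pos_def)
  then show ?thesis
    using sum assms(2) by simp
qed

lemma is_adjoint_unique:
  assumes "is_adjoint H T S" "is_adjoint H T S'"
  shows "S = S'"
proof (rule extensionalityI[of _ "carrier H"])
  show "S \<in> extensional (carrier H)" "S' \<in> extensional (carrier H)"
    using assms by (simp_all add: is_adjoint_def endomorphisms_def)
  fix \<phi> assume \<phi>: "\<phi> \<in> carrier H"
  then have S: "S \<phi> \<in> carrier H" "S' \<phi> \<in> carrier H"
    using assms by (auto simp: is_adjoint_def endomorphisms_def linear_map_def)
  then show "S \<phi> = S' \<phi>"
    using assms \<phi> ip_cnj[OF _ S(1)] ip_cnj[OF _ S(2)]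
    by (intro eq_by_ip) (simp_all add: is_adjoint_def)
qed

end

section \<open>Characterisation of GNS representations\<close>

locale gns_model = A: star_algebra A + H: pre_hilbert H
  for A :: "('r::linordered_idom cx, 'a, 'm) star_algebra_scheme"
    and H :: "('r cx, 'h, 'n) pre_hilbert_scheme" +
  fixes \<omega> :: "'a \<Rightarrow> 'r cx" and \<rho> :: "'a \<Rightarrow> 'h \<Rightarrow> 'h" and v :: "'a \<Rightarrow> 'h"
  assumes linear: "linear_functional A \<omega>"
    and v_onto: "v ` carrier A = carrier H"
    and ip_v: "\<lbrakk>a \<in> carrier A; b \<in> carrier A\<rbrakk> \<Longrightarrow> ip H (v a) (v b) = \<omega> (star A a \<otimes>\<^bsub>A\<^esub> b)"
    and rho_extensional: "a \<in> carrier A \<Longrightarrow> \<rho> a \<in> extensional (carrier H)"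
    and rho_v: "\<lbrakk>a \<in> carrier A; b \<in> carrier A\<rbrakk> \<Longrightarrow> \<rho> a (v b) = v (a \<otimes>\<^bsub>A\<^esub> b)"
begin

lemma v_closed: "a \<in> carrier A \<Longrightarrow> v a \<in> carrier H"
  using v_onto by blast

lemma v_cases:
  assumes "\<phi> \<in> carrier H"
  obtains b where "b \<in> carrier A" "\<phi> = v b"
  using assms v_onto by blast

lemma smult_closed: "a \<in> carrier A \<Longrightarrow> z \<odot>\<^bsub>A\<^esub> a \<in> carrier A"
  by simp

lemmas closed = A.M.a_closed smult_closed A.mult_closed A.star_closed v_closed

lemma omega_add: "\<lbrakk>a \<in> carrier A; b \<in> carrier A\<rbrakk> \<Longrightarrow> \<omega> (a \<oplus>\<^bsub>A\<^esub> b) = \<omega> a + \<omega> b"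
  and omega_smult: "a \<in> carrier A \<Longrightarrow> \<omega> (z \<odot>\<^bsub>A\<^esub> a) = z * \<omega> a"
  using linear by (simp_all add: linear_functional_def)

text \<open>
  The vectors \<open>v c\<close> separate points, so that identities between vectors follow from identities for \<open>\<omega>\<close>.
\<close>

lemma v_eqI:
  assumes "a \<in> carrier A" "\<phi> \<in> carrier H"
    and "\<And>c. c \<in> carrier A \<Longrightarrow> ip H (v c) (v a) = ip H (v c) \<phi>"
  shows "v a = \<phi>"
proof (rule H.eq_by_ip)
  fix \<chi> assume "\<chi> \<in> carrier H"
  then obtain c where "c \<in> carrier A" "\<chi> = v c"
    using v_onto by blast
  then show "ip H \<chi> (v a) = ip H \<chi> \<phi>"
    using assms(3) by simp
qed (use assms v_closed in auto)

lemma v_add: "\<lbrakk>a \<in> carrier A; b \<in> carrier A\<rbrakk> \<Longrightarrow> v (a \<oplus>\<^bsub>A\<^esub> b) = v a \<oplus>\<^bsub>H\<^esub> v b"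
  by (rule v_eqI) (simp_all add: H.ip_add ip_v A.mult_add_right omega_add closed)

lemma v_smult: "a \<in> carrier A \<Longrightarrow> v (z \<odot>\<^bsub>A\<^esub> a) = z \<odot>\<^bsub>H\<^esub> v a"
  by (rule v_eqI)
    (simp_all add: H.ip_smult H.smult_carrier ip_v A.mult_smult_right omega_smult closed)

lemma rho_adjoint:
  assumes "a \<in> carrier A" "\<phi> \<in> carrier H" "\<psi> \<in> carrier H"
  shows "ip H (\<rho> (star A a) \<phi>) \<psi> = ip H \<phi> (\<rho> a \<psi>)"
proof -
  obtain b c where "b \<in> carrier A" "\<phi> = v b" "c \<in> carrier A" "\<psi> = v c"
    using assms v_onto by blast
  then show ?thesis
    using assms(1)
    by (simp add: rho_v ip_v closed A.star_mult A.star_star A.mult_assoc)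
qed

lemma rho_endomorphism:
  assumes "a \<in> carrier A"
  shows "\<rho> a \<in> endomorphisms H"
  using assms
  by (auto simp: endomorphisms_def linear_map_def rho_extensional rho_v closed
      A.mult_add_right A.mult_smult_right simp flip: v_add v_smult elim!: v_cases)

lemma rho_star:
  assumes "a \<in> carrier A"
  shows "is_adjoint H (\<rho> a) (\<rho> (star A a))"
  using assms by (simp add: is_adjoint_def rho_endomorphism rho_adjoint closed)

lemma rho_eqI:
  assumes "a \<in> carrier A" "T \<in> extensional (carrier H)"
    and "\<And>b. b \<in> carrier A \<Longrightarrow> v (a \<otimes>\<^bsub>A\<^esub> b) = T (v b)"
  shows "\<rho> a = T"
  using assms
  by (intro extensionalityI[of _ "carrier H"]) (auto simp: rho_extensional rho_v elim!: v_cases)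

text \<open>
  The laws of a representation are the laws of the algebra read through \<open>v\<close>, and \<open>\<rho> (a\<^sup>*)\<close> is the only
  possible adjoint of \<open>\<rho> a\<close> by nondegeneracy.
\<close>

theorem star_representation_rho: "star_representation A H \<rho>"
proof -
  let ?B = "adjointable_operators H"
  have "\<rho> (star A a) = star ?B (\<rho> a)" if "a \<in> carrier A" for a
    using rho_star[OF that] H.is_adjoint_unique
    by (simp add: adjointable_operators_def the_equality)
  moreover have "\<rho> a \<in> carrier ?B" if "a \<in> carrier A" for a
    using rho_star[OF that] rho_endomorphism[OF that] by (auto simp: adjointable_operators_def)
  moreover have "\<rho> (a \<oplus>\<^bsub>A\<^esub> b) = \<rho> a \<oplus>\<^bsub>?B\<^esub> \<rho> b" "\<rho> (a \<otimes>\<^bsub>A\<^esub> b) = \<rho> a \<otimes>\<^bsub>?B\<^esub> \<rho> b"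
    if "a \<in> carrier A" "b \<in> carrier A" for a b
    using that by (auto intro!: rho_eqI simp: adjointable_operators_def closed rho_v
        A.mult_add_left A.mult_assoc v_add compose_eq)
  moreover have "\<rho> (z \<odot>\<^bsub>A\<^esub> a) = z \<odot>\<^bsub>?B\<^esub> \<rho> a" if "a \<in> carrier A" for z a
    using that by (auto intro!: rho_eqI simp: adjointable_operators_def closed rho_v
        A.mult_smult_left v_smult)
  ultimately have "star_hom A ?B \<rho>"
    by (simp add: star_hom_def linear_map_def)
  then show ?thesis
    by (simp add: star_representation_def A.star_algebra_axioms H.pre_hilbert_axioms)
qed

end

text \<open>
  Since \<open>v a\<close> and \<open>w a\<close> have the same inner products \<open>\<omega>(a\<^sup>* b)\<close>, coincidences between vectors occur in both
  models for the same arguments.  Hence \<open>v a \<mapsto> w a\<close> is a well-defined bijection, and it inherits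
  all other properties from those of \<open>v\<close> and \<open>w\<close>.
\<close>

theorem gns_model_unique:
  assumes "gns_model A H \<omega> \<rho> v" and "gns_model A K \<omega> \<sigma> w"
  shows "\<exists>U. (\<forall>a\<in>carrier A. U (v a) = w a) \<and> unitary_intertwiner A H \<rho> K \<sigma> U"
proof -
  interpret H: gns_model A H \<omega> \<rho> v by fact
  interpret K: gns_model A K \<omega> \<sigma> w by fact
  have eq_iff: "v a = v b \<longleftrightarrow> w a = w b" if "a \<in> carrier A" "b \<in> carrier A" for a b
    using that H.v_eqI[of a "v b"] K.v_eqI[of a "w b"]
    by (metis H.ip_v K.ip_v H.v_closed K.v_closed)
  define U where "U = (\<lambda>\<phi>. w (inv_into (carrier A) v \<phi>))"
  have U: "U (v a) = w a" if "a \<in> carrier A" for a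
    using that eq_iff[of "inv_into (carrier A) v (v a)" a]
    by (simp add: U_def inv_into_into f_inv_into_f)
  have "linear_map H K U"
    by (auto simp: linear_map_def U K.v_closed H.closed K.v_add K.v_smult
        simp flip: H.v_add H.v_smult elim!: H.v_cases)
  moreover have "bij_betw U (carrier H) (carrier K)"
    by (auto simp: bij_betw_def inj_on_def U eq_iff H.v_onto[symmetric] K.v_onto[symmetric]
        image_image)
  moreover have "ip K (U \<phi>) (U \<psi>) = ip H \<phi> \<psi>" if "\<phi> \<in> carrier H" "\<psi> \<in> carrier H" for \<phi> \<psi>
    using that by (auto simp: U H.ip_v K.ip_v elim!: H.v_cases)
  ultimately have "unitary_map H K U"
    by (simp add: unitary_map_def H.H.pre_hilbert_axioms K.H.pre_hilbert_axioms)
  moreover have "U (\<rho> a \<phi>) = \<sigma> a (U \<phi>)" if "a \<in> carrier A" "\<phi> \<in> carrier H" for a \<phi>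
    using that by (auto simp: U H.rho_v K.rho_v H.closed elim!: H.v_cases)
  ultimately show ?thesis
    using U H.star_representation_rho K.star_representation_rho
    by (auto simp: unitary_intertwiner_def)
qed

section \<open>The GNS construction as a model\<close>

lemma positive_functional_semi_hilbert:
  assumes "star_algebra A" and "positive_functional A \<omega>"
  shows "semi_hilbert A (smult A) (\<lambda>a b. \<omega> (star A a \<otimes>\<^bsub>A\<^esub> b))"
proof -
  interpret A: star_algebra A by fact
  have smult: "z \<odot>\<^bsub>A\<^esub> a \<in> carrier A" if "a \<in> carrier A" for z a
    using that by simp
  have add: "\<omega> (a \<oplus>\<^bsub>A\<^esub> b) = \<omega> a + \<omega> b" if "a \<in> carrier A" "b \<in> carrier A" for a b
    using assms(2) that by (simp add: positive_functional_def linear_functional_def)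
  have scale: "\<omega> (z \<odot>\<^bsub>A\<^esub> a) = z * \<omega> a" if "a \<in> carrier A" for z a
    using assms(2) that by (simp add: positive_functional_def linear_functional_def)
  show ?thesis
  proof (intro semi_hilbert.intro semi_hilbert_axioms.intro A.M.abelian_group_axioms)
    fix a b c assume "a \<in> carrier A" "b \<in> carrier A" "c \<in> carrier A"
    then show "\<omega> (star A (a \<oplus>\<^bsub>A\<^esub> b) \<otimes>\<^bsub>A\<^esub> c) = \<omega> (star A a \<otimes>\<^bsub>A\<^esub> c) + \<omega> (star A b \<otimes>\<^bsub>A\<^esub> c)"
      and "\<omega> (star A c \<otimes>\<^bsub>A\<^esub> (a \<oplus>\<^bsub>A\<^esub> b)) = \<omega> (star A c \<otimes>\<^bsub>A\<^esub> a) + \<omega> (star A c \<otimes>\<^bsub>A\<^esub> b)"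
      by (simp_all add: A.star_add A.mult_add_left A.mult_add_right A.star_closed A.mult_closed add)
  next
    fix a b z assume "a \<in> carrier A" "b \<in> carrier A"
    then show "\<omega> (star A (z \<odot>\<^bsub>A\<^esub> a) \<otimes>\<^bsub>A\<^esub> b) = cx_cnj z * \<omega> (star A a \<otimes>\<^bsub>A\<^esub> b)"
      and "\<omega> (star A a \<otimes>\<^bsub>A\<^esub> (z \<odot>\<^bsub>A\<^esub> b)) = z * \<omega> (star A a \<otimes>\<^bsub>A\<^esub> b)"
      by (simp_all add: A.star_smult A.mult_smult_left A.mult_smult_right A.star_closed
          A.mult_closed scale)
  next
    fix a assume "a \<in> carrier A"
    then show "cx_nonneg (\<omega> (star A a \<otimes>\<^bsub>A\<^esub> a))"
      using assms(2) by (simp add: positive_functional_def)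
  qed (use A.smult_l_distr A.smult_r_distr A.smult_assoc1 A.smult_one smult in auto)
qed

text \<open>
  Left multiplication by \<open>a\<^sup>*\<close> is the formal adjoint of left multiplication by \<open>a\<close>, which is why
  \<open>\<pi>\<^sub>\<omega>(a)\<close> is well defined; that the Gelfand ideal is a left ideal is implicit in this.
\<close>

theorem gns_model_gns:
  assumes "star_algebra A" and "positive_functional A \<omega>"
  shows "gns_model A (gns_space A \<omega>) \<omega> (gns_rep A \<omega>) (gns_vector A \<omega>)"
proof -
  interpret A: star_algebra A by fact
  interpret S: semi_hilbert A "smult A" "\<lambda>a b. \<omega> (star A a \<otimes>\<^bsub>A\<^esub> b)"
    using assms by (rule positive_functional_semi_hilbert)
  have ideal: "gelfand_ideal A \<omega> = S.isotropic"
    by (simp add: gelfand_ideal_def S.isotropic_def)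
  have vector: "gns_vector A \<omega> = S.cls"
    by (simp add: gns_vector_def ideal fun_eq_iff)
  have space: "gns_space A \<omega> = S.quot"
    by (simp add: gns_space_def ideal)
  show ?thesis
    unfolding space vector
  proof (intro gns_model.intro gns_model_axioms.intro A.star_algebra_axioms S.pre_hilbert_quot)
    show "linear_functional A \<omega>"
      using assms(2) by (simp add: positive_functional_def)
    show "S.cls ` carrier A = carrier S.quot"
      by (simp only: S.quot_carrier)
    fix a assume a: "a \<in> carrier A"
    show "gns_rep A \<omega> a \<in> extensional (carrier S.quot)"
      by (simp add: gns_rep_def space)
    fix b assume b: "b \<in> carrier A"
    show "ip S.quot (S.cls a) (S.cls b) = \<omega> (star A a \<otimes>\<^bsub>A\<^esub> b)"
      using a b by (rule S.quot_ip)
    have "the_elem ((\<lambda>b. S.cls (a \<otimes>\<^bsub>A\<^esub> b)) ` S.cls b) = S.cls (a \<otimes>\<^bsub>A\<^esub> b)"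
      using a b
      by (intro S.operator_on_cls[where S = "\<lambda>c. star A a \<otimes>\<^bsub>A\<^esub> c"])
        (simp_all add: A.mult_closed A.star_closed A.star_mult A.star_star A.mult_assoc)
    then show "gns_rep A \<omega> a (S.cls b) = S.cls (a \<otimes>\<^bsub>A\<^esub> b)"
      using b by (simp add: gns_rep_def space vector S.quot_carrier)
  qed
qed

section \<open>The classical limit as a quotient\<close>

lemma cx_nth_0_add: "cx_nth (z + w) 0 = cx_nth z 0 + cx_nth w 0"
  and cx_nth_0_mult: "cx_nth (z * w) 0 = cx_nth z 0 * cx_nth w 0"
  and cx_nth_0_cnj: "cx_nth (cx_cnj z) 0 = cx_cnj (cx_nth z 0)"
  and cx_nth_0_const: "cx_nth (cx_const c) 0 = c"
  by (simp_all add: cx_nth_def cx_const_def cx_eq_iff)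

lemma cx_const_add: "cx_const (c + d) = cx_const c + cx_const d"
  and cx_const_mult: "cx_const (c * d) = cx_const c * cx_const d"
  and cx_const_one: "cx_const 1 = 1"
  by (simp_all add: cx_const_def cx_eq_iff)

text \<open>
  The sign of a series is that of its leading coefficient, so evaluation at \<open>\<lambda> = 0\<close> is monotone but not
  strictly so; this is why the inner product at \<open>\<lambda> = 0\<close> is only semidefinite.
\<close>

lemma fps_nonneg_nth_0:
  fixes f :: "'r::linordered_idom fps"
  assumes "0 \<le> f"
  shows "0 \<le> fps_nth f 0"
proof (cases "subdegree f = 0")
  case True
  then show ?thesis
    using assms by (auto simp: less_eq_fps_def fps_pos_def)
next
  case False
  then show ?thesis
    by (simp add: nth_less_subdegree_zero)
qed

lemma cx_nonneg_nth_0: "cx_nonneg z \<Longrightarrow> cx_nonneg (cx_nth z 0)"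
  by (simp add: cx_nonneg_def cx_nth_def fps_nonneg_nth_0)

lemma classical_limit_semi_hilbert:
  assumes "pre_hilbert H"
  shows "semi_hilbert H (\<lambda>z \<phi>. cx_const z \<odot>\<^bsub>H\<^esub> \<phi>) (\<lambda>\<phi> \<psi>. cx_nth (ip H \<phi> \<psi>) 0)"
proof -
  interpret H: pre_hilbert H by fact
  have nonneg: "cx_nonneg (ip H \<phi> \<phi>)" if "\<phi> \<in> carrier H" for \<phi>
    using H.ip_pos[OF that] H.ip_zero[OF that]
    by (cases "\<phi> = \<zero>\<^bsub>H\<^esub>") (auto simp: cx_pos_def cx_nonneg_def)
  show ?thesis
    by (intro semi_hilbert.intro semi_hilbert_axioms.intro H.M.abelian_group_axioms)
      (use H.smult_l_distr H.smult_r_distr H.smult_assoc1 H.smult_one in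
        \<open>auto simp: H.ip_add H.ip_add_left H.ip_smult H.ip_smult_left H.smult_carrier
          cx_nth_0_add cx_nth_0_mult cx_nth_0_cnj cx_nth_0_const
          cx_const_add cx_const_mult cx_const_one cx_nonneg_nth_0 nonneg\<close>)
qed

section \<open>Deformations modulo the formal parameter\<close>

definition cx_lambda :: "'r::comm_ring_1 fps cx"
  where "cx_lambda = Cx fps_X 0"

lemma cx_nth_lambda: "cx_nth cx_lambda n = (if n = 1 then 1 else 0)"
  by (simp add: cx_nth_def cx_lambda_def cx_eq_iff fps_X_def)

locale deformed_star_algebra = A: star_algebra A
  for A :: "('r::linordered_idom cx, 'a, 'm) star_algebra_scheme" +
  fixes m :: "(nat \<Rightarrow> 'a) \<Rightarrow> (nat \<Rightarrow> 'a) \<Rightarrow> (nat \<Rightarrow> 'a)"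
  assumes deformation: "hermitian_deformation A m"
begin

abbreviation "B \<equiv> series_algebra A m"

sublocale B: star_algebra B
  using deformation by (simp add: hermitian_deformation_def)

lemma series_carrier: "f \<in> carrier B \<longleftrightarrow> (\<forall>n. f n \<in> carrier A)"
  and series_add: "f \<oplus>\<^bsub>B\<^esub> g = (\<lambda>n. f n \<oplus>\<^bsub>A\<^esub> g n)"
  and series_mult: "f \<otimes>\<^bsub>B\<^esub> g = m f g"
  and series_star: "star B f = (\<lambda>n. star A (f n))"
  by (simp_all add: series_algebra_def)

lemma series_const_closed: "a \<in> carrier A \<Longrightarrow> series_const A a \<in> carrier B"
  by (simp add: series_carrier series_const_def)

lemma series_const_0: "series_const A a 0 = a"
  by (simp add: series_const_def)

lemma lambda_smult:
  assumes "f \<in> carrier B"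
  shows "cx_lambda \<odot>\<^bsub>B\<^esub> f = (\<lambda>n. case n of 0 \<Rightarrow> \<zero>\<^bsub>A\<^esub> | Suc k \<Rightarrow> f k)"
proof
  fix n
  have f: "f k \<in> carrier A" for k
    using assms by (simp add: series_carrier)
  have zero: "0 \<odot>\<^bsub>A\<^esub> a = \<zero>\<^bsub>A\<^esub>" and one: "1 \<odot>\<^bsub>A\<^esub> a = a" if "a \<in> carrier A" for a
    using A.smult_l_null[OF that] A.smult_one[OF that] by simp_all
  have "(cx_lambda \<odot>\<^bsub>B\<^esub> f) n = (\<Oplus>\<^bsub>A\<^esub>k\<in>{..n}. cx_nth cx_lambda k \<odot>\<^bsub>A\<^esub> f (n - k))"
    by (simp add: series_algebra_def)
  also have "\<dots> = (\<Oplus>\<^bsub>A\<^esub>k\<in>{..n}. if 1 = k then f (n - k) else \<zero>\<^bsub>A\<^esub>)"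
    using f by (intro A.M.finsum_cong') (auto simp: cx_nth_lambda zero one)
  also have "\<dots> = (case n of 0 \<Rightarrow> \<zero>\<^bsub>A\<^esub> | Suc k \<Rightarrow> f k)"
  proof (cases n)
    case 0
    then show ?thesis
      by simp
  next
    case (Suc k)
    then show ?thesis
      using f A.M.finsum_singleton[of 1 "{..n}" "\<lambda>k. f (n - k)"] by simp
  qed
  finally show "(cx_lambda \<odot>\<^bsub>B\<^esub> f) n = (case n of 0 \<Rightarrow> \<zero>\<^bsub>A\<^esub> | Suc k \<Rightarrow> f k)" .
qed

lemma tail_closed: "f \<in> carrier B \<Longrightarrow> (\<lambda>n. f (Suc n)) \<in> carrier B"
  by (simp add: series_carrier)

lemma smult_series_closed: "f \<in> carrier B \<Longrightarrow> z \<odot>\<^bsub>B\<^esub> f \<in> carrier B"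
  by simp

text \<open>
  A series is its constant term plus \<open>\<lambda>\<close> times its tail.  Hence a \<open>C[[\<lambda>]]\<close>-linear map is determined
  modulo \<open>\<lambda>\<close> by its values on constant series; no infinite sum has to be exchanged with the map.
\<close>

lemma series_split:
  assumes "f \<in> carrier B"
  shows "f = series_const A (f 0) \<oplus>\<^bsub>B\<^esub> cx_lambda \<odot>\<^bsub>B\<^esub> (\<lambda>n. f (Suc n))"
proof
  fix n
  show "f n = (series_const A (f 0) \<oplus>\<^bsub>B\<^esub> cx_lambda \<odot>\<^bsub>B\<^esub> (\<lambda>n. f (Suc n))) n"
    using assms tail_closed[OF assms]
    by (cases n) (simp_all add: lambda_smult series_add series_carrier series_const_def)
qed

lemma series_mult_0:
  assumes f: "f \<in> carrier B" and g: "g \<in> carrier B"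
  shows "(f \<otimes>\<^bsub>B\<^esub> g) 0 = f 0 \<otimes>\<^bsub>A\<^esub> g 0"
proof -
  have f0: "f 0 \<in> carrier A" and g0: "g 0 \<in> carrier A"
    using f g by (simp_all add: series_carrier)
  note c = series_const_closed[OF f0] series_const_closed[OF g0] tail_closed[OF f] tail_closed[OF g]
  have lambda_0: "(h \<oplus>\<^bsub>B\<^esub> cx_lambda \<odot>\<^bsub>B\<^esub> k) 0 = h 0" if "h \<in> carrier B" "k \<in> carrier B" for h k
    using that by (simp add: lambda_smult series_add series_carrier)
  have "(f \<otimes>\<^bsub>B\<^esub> g) 0 = (series_const A (f 0) \<otimes>\<^bsub>B\<^esub> g
      \<oplus>\<^bsub>B\<^esub> cx_lambda \<odot>\<^bsub>B\<^esub> ((\<lambda>n. f (Suc n)) \<otimes>\<^bsub>B\<^esub> g)) 0"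
    using c g
    by (subst series_split[OF f])
      (simp only: B.mult_add_left B.mult_smult_left smult_series_closed)
  also have "\<dots> = (series_const A (f 0) \<otimes>\<^bsub>B\<^esub> g) 0"
    using c g by (intro lambda_0 B.mult_closed)
  also have "\<dots> = (series_const A (f 0) \<otimes>\<^bsub>B\<^esub> series_const A (g 0)
      \<oplus>\<^bsub>B\<^esub> cx_lambda \<odot>\<^bsub>B\<^esub> (series_const A (f 0) \<otimes>\<^bsub>B\<^esub> (\<lambda>n. g (Suc n)))) 0"
    using c
    by (subst series_split[OF g])
      (simp only: B.mult_add_right B.mult_smult_right smult_series_closed)
  also have "\<dots> = (series_const A (f 0) \<otimes>\<^bsub>B\<^esub> series_const A (g 0)) 0"
    using c by (intro lambda_0 B.mult_closed)
  also have "\<dots> = f 0 \<otimes>\<^bsub>A\<^esub> g 0"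
    using deformation f0 g0 by (auto simp: hermitian_deformation_def series_mult)
  finally show ?thesis .
qed

lemma functional_nth_0:
  assumes "linear_functional B \<Omega>" and "functional_deformation A \<omega> \<Omega>" and f: "f \<in> carrier B"
  shows "cx_nth (\<Omega> f) 0 = \<omega> (f 0)"
proof -
  have f0: "f 0 \<in> carrier A"
    using f by (simp add: series_carrier)
  have "\<Omega> f = \<Omega> (series_const A (f 0)) + cx_lambda * \<Omega> (\<lambda>n. f (Suc n))"
    using assms(1) series_const_closed[OF f0] tail_closed[OF f]
    by (subst series_split[OF f]) (simp only: linear_functional_def smult_series_closed)
  then have "cx_nth (\<Omega> f) 0 = cx_nth (\<Omega> (series_const A (f 0))) 0"
    by (simp add: cx_nth_0_add cx_nth_0_mult cx_nth_lambda)
  also have "\<dots> = \<omega> (f 0)"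
    using assms(2) f0 by (auto simp: functional_deformation_def)
  finally show ?thesis .
qed

end

section \<open>The classical limit of the deformed GNS representation\<close>

text \<open>
  At \<open>\<lambda> = 0\<close> the inner product of the deformed GNS vectors of \<open>f\<close> and \<open>g\<close> is \<open>\<omega>(f\<^sub>0\<^sup>* g\<^sub>0)\<close>.  By nondegeneracy
  the class \<open>V f\<close> therefore remembers only \<open>f\<^sub>0\<close>.  This makes \<open>V\<close> surjective already on constant series.
  It also explains why the limit representation multiplies vectors by the undeformed product: the
  constant series of \<open>a b\<close> and the deformed product of the constant series of \<open>a\<close> and \<open>b\<close> agree in
  order zero.
\<close>

lemma gns_model_classical_limit:
  assumes "star_algebra A" and "hermitian_deformation A m"
    and "positive_functional A \<omega>" and "positive_functional (series_algebra A m) \<Omega>"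
    and "functional_deformation A \<omega> \<Omega>"
  defines "B \<equiv> series_algebra A m"
  defines "H \<equiv> gns_space B \<Omega>"
  defines "V \<equiv> \<lambda>f. cl_vector H (gns_vector B \<Omega> f)"
  shows "gns_model A (cl_space H) \<omega> (cl_rep A H (gns_rep B \<Omega>)) (\<lambda>a. V (series_const A a))"
    and "f \<in> carrier B \<Longrightarrow> V f = V (series_const A (f 0))"
proof -
  interpret D: deformed_star_algebra A m
    using assms(1,2) by (intro deformed_star_algebra.intro deformed_star_algebra_axioms.intro)
  interpret G: gns_model B H \<Omega> "gns_rep B \<Omega>" "gns_vector B \<Omega>"
    unfolding B_def H_def using D.B.star_algebra_axioms assms(4) by (rule gns_model_gns)
  interpret C: semi_hilbert H "\<lambda>z \<phi>. cx_const z \<odot>\<^bsub>H\<^esub> \<phi>" "\<lambda>\<phi> \<psi>. cx_nth (ip H \<phi> \<psi>) 0"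
    using G.H.pre_hilbert_axioms by (rule classical_limit_semi_hilbert)
  note D = D.series_const_closed[folded B_def] D.series_carrier[folded B_def]
    D.series_star[folded B_def] D.series_mult_0[folded B_def]
    D.functional_nth_0[folded B_def, OF G.linear assms(5)]
  have space: "cl_space H = C.quot" and vector: "cl_vector H = C.cls"
    by (simp_all add: cl_space_def cl_vector_def null_space_def C.isotropic_def fun_eq_iff)
  have ip_0: "cx_nth (ip H (gns_vector B \<Omega> f) (gns_vector B \<Omega> g)) 0
      = \<omega> (star A (f 0) \<otimes>\<^bsub>A\<^esub> g 0)" if "f \<in> carrier B" "g \<in> carrier B" for f g
    using that G.A.star_closed[OF that(1)] G.A.mult_closed[of "star B f" g]
    by (simp add: G.ip_v D)
  have ip_V: "ip C.quot (V f) (V g) = \<omega> (star A (f 0) \<otimes>\<^bsub>A\<^esub> g 0)"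
    if "f \<in> carrier B" "g \<in> carrier B" for f g
    using that by (simp add: V_def vector C.quot_ip G.v_closed ip_0)
  have V_eq: "V f = V g" if "f \<in> carrier B" "g \<in> carrier B" "f 0 = g 0" for f g
    unfolding V_def vector C.cls_eq_iff[OF G.v_closed[OF that(1)] G.v_closed[OF that(2)]]
    using that by (auto simp: ip_0 elim!: G.v_cases)
  show V_const: "V f = V (series_const A (f 0))" if "f \<in> carrier B" for f
    using that D(1)[of "f 0"] D(2)[of f] by (intro V_eq) (simp_all add: D.series_const_0)
  have V_onto: "V ` carrier B = carrier C.quot"
    by (simp add: V_def vector C.quot_carrier image_image flip: G.v_onto)
  have rep_V: "cl_rep A H (gns_rep B \<Omega>) a (V f) = V (series_const A a \<otimes>\<^bsub>B\<^esub> f)"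
    if a: "a \<in> carrier A" and f: "f \<in> carrier B" for a f
  proof -
    let ?T = "gns_rep B \<Omega> (series_const A a)"
    have c: "series_const A a \<in> carrier B"
      using a by (rule D)
    have closed: "gns_rep B \<Omega> g \<phi> \<in> carrier H" if "g \<in> carrier B" "\<phi> \<in> carrier H" for g \<phi>
      using that by (auto simp: G.rho_v G.closed elim!: G.v_cases)
    \<comment> \<open>The adjoint over \<open>C[[\<lambda>]]\<close> remains a formal adjoint for the form at \<open>\<lambda> = 0\<close>.\<close>
    have "the_elem ((\<lambda>\<psi>. C.cls (?T \<psi>)) ` C.cls (gns_vector B \<Omega> f))
        = C.cls (?T (gns_vector B \<Omega> f))"
      using c f G.v_closed
      by (intro C.operator_on_cls[where S = "gns_rep B \<Omega> (star B (series_const A a))"])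
        (simp_all add: closed G.A.star_closed G.rho_adjoint)
    then show ?thesis
      using c f G.v_closed[OF f]
      by (simp add: cl_rep_def space vector V_def C.quot_carrier G.rho_v)
  qed
  show "gns_model A (cl_space H) \<omega> (cl_rep A H (gns_rep B \<Omega>)) (\<lambda>a. V (series_const A a))"
    unfolding space
  proof (intro gns_model.intro gns_model_axioms.intro C.pre_hilbert_quot assms(1))
    show "linear_functional A \<omega>"
      using assms(3) by (simp add: positive_functional_def)
    have "V ` carrier B \<subseteq> (\<lambda>a. V (series_const A a)) ` carrier A"
      using V_const by (auto simp: D)
    moreover have "(\<lambda>a. V (series_const A a)) ` carrier A \<subseteq> V ` carrier B"
      using D(1) by blast
    ultimately show "(\<lambda>a. V (series_const A a)) ` carrier A = carrier C.quot"
      by (simp only: V_onto[symmetric] set_eq_subset simp_thms)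
    fix a assume a: "a \<in> carrier A"
    show "cl_rep A H (gns_rep B \<Omega>) a \<in> extensional (carrier C.quot)"
      by (simp add: cl_rep_def space)
    fix b assume b: "b \<in> carrier A"
    show "ip C.quot (V (series_const A a)) (V (series_const A b)) = \<omega> (star A a \<otimes>\<^bsub>A\<^esub> b)"
      using a b by (simp add: ip_V D(1) D.series_const_0)
    have "V (series_const A a \<otimes>\<^bsub>B\<^esub> series_const A b) = V (series_const A (a \<otimes>\<^bsub>A\<^esub> b))"
      using a b D.A.mult_closed[OF a b] G.A.mult_closed[OF D(1)[OF a] D(1)[OF b]]
      by (intro V_eq) (simp_all add: D(1) D(4) D.series_const_0)
    then show "cl_rep A H (gns_rep B \<Omega>) a (V (series_const A b)) = V (series_const A (a \<otimes>\<^bsub>A\<^esub> b))"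
      using rep_V[OF a D(1)[OF b]] by simp
  qed
qed

theorem theorem4p1:
  fixes A :: "('r::linordered_idom cx, 'a) star_algebra"
    and m :: "(nat \<Rightarrow> 'a) \<Rightarrow> (nat \<Rightarrow> 'a) \<Rightarrow> (nat \<Rightarrow> 'a)"
    and \<omega> :: "'a \<Rightarrow> 'r cx"
    and \<Omega> :: "(nat \<Rightarrow> 'a) \<Rightarrow> 'r fps cx"
  assumes "star_algebra A"
    and "hermitian_deformation A m"
    and "positive_functional A \<omega>"
    and "positive_functional (series_algebra A m) \<Omega>"
    and "functional_deformation A \<omega> \<Omega>"
  shows "\<exists>U. (\<forall>a\<in>carrier (series_algebra A m).
        U (cl_vector (gns_space (series_algebra A m) \<Omega>) (gns_vector (series_algebra A m) \<Omega> a))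
          = gns_vector A \<omega> (a 0)) \<and>
      unitary_intertwiner A
        (cl_space (gns_space (series_algebra A m) \<Omega>))
        (cl_rep A (gns_space (series_algebra A m) \<Omega>) (gns_rep (series_algebra A m) \<Omega>))
        (gns_space A \<omega>)
        (gns_rep A \<omega>)
        U"
proof -
  let ?B = "series_algebra A m"
  let ?V = "\<lambda>f. cl_vector (gns_space ?B \<Omega>) (gns_vector ?B \<Omega> f)"
  note limit = gns_model_classical_limit[OF assms]
  obtain U where U: "\<forall>a\<in>carrier A. U (?V (series_const A a)) = gns_vector A \<omega> a"
    and "unitary_intertwiner A (cl_space (gns_space ?B \<Omega>))
      (cl_rep A (gns_space ?B \<Omega>) (gns_rep ?B \<Omega>)) (gns_space A \<omega>) (gns_rep A \<omega>) U"
    using gns_model_unique[OF limit(1) gns_model_gns[OF assms(1,3)]] by blast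
  moreover have "U (?V f) = gns_vector A \<omega> (f 0)" if "f \<in> carrier ?B" for f
  proof -
    have "f 0 \<in> carrier A"
      using that by (simp add: series_algebra_def)
    then show ?thesis
      using U limit(2)[OF that] by simp
  qed
  ultimately show ?thesis
    by blast
qed

end
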